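(* Let $l\in\mathbb{N}\cup\{0\}$ and let $S$ be the $(p,m,2)$ signed graph consisting of a positive edge $z_1z_2$, to which are attached $l$ positive pendant edges $z_1v_i$ ($1\le i\le l$) and $2$ negative pendant edges $z_1u_1,z_1u_2$ at one end as well as $2$ positive pendant edges $z_2w_1,z_2w_2$ at the other end. Then $S$ is additively graceful. Further, for each $l\in\mathbb{N}\cup\{0\}$, the additively graceful labeling of $S$ is unique up to rearrangement of labels among the $u_i$'s, among the $v_i$'s and among the $w_i$'s.
   Context: A signed graph $S$ is a finite simple graph on $p$ vertices in which $m$ edges are specified as positive and the remaining $n$ edges are specified as negative; it is then called a $(p,m,n)$ signed graph, with sets of positive and negative edges $E^+(S)$ and $E^-(S)$. Attaching a pendant edge at a vertex $z$ means adding a new vertex of degree 1 joined to $z$; all the named vertices of $S$ are distinct and $S$ has no other vertices or edges. An additively graceful labeling of a $(p,m,n)$ signed graph $S=(V,E)$ is an injective map $f:V\to\{0,1,\dots,m+\lceil\frac{n+1}{2}\rceil\}$ such that, with $f^*(uv)=f(u)+f(v)$ for $uv\in E^-(S)$ and $f^*(uv)=|f(u)-f(v)|$ for $uv\in E^+(S)$, one has $\{f^*(uv):uv\in E^-(S)\}=\{1,2,\dots,n\}$ and $\{f^*(uv):uv\in E^+(S)\}=\{1,2,\dots,m\}$. $S$ is additively graceful if it admits such a labeling. *)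

theory Defs
  imports Complex_Main "HOL-Combinatorics.Permutations"
begin

record 'a sgraph =
  verts :: "'a set"
  pos_edges :: "'a set set"
  neg_edges :: "'a set set"

definition signed_graph :: "'a sgraph \<Rightarrow> bool" where
  "signed_graph S \<longleftrightarrow>
     finite (verts S) \<and>
     (\<forall>e \<in> pos_edges S \<union> neg_edges S. e \<subseteq> verts S \<and> card e = 2) \<and>
     pos_edges S \<inter> neg_edges S = {}"

definition pmn_signed_graph :: "nat \<Rightarrow> nat \<Rightarrow> nat \<Rightarrow> 'a sgraph \<Rightarrow> bool" where
  "pmn_signed_graph p m n S \<longleftrightarrow>
     signed_graph S \<and> card (verts S) = p \<and>
     card (pos_edges S) = m \<and> card (neg_edges S) = n"

text \<open>A labeling is a total function on the vertex type, but only its values on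
  \<^term>\<open>verts S\<close> are constrained. The parameters \<open>m\<close> and \<open>n\<close> are
  the numbers of positive and negative edges of \<open>S\<close>.\<close>

definition additively_graceful_labeling :: "'a sgraph \<Rightarrow> ('a \<Rightarrow> nat) \<Rightarrow> bool" where
  "additively_graceful_labeling S f \<longleftrightarrow>
     (let m = card (pos_edges S); n = card (neg_edges S) in
        inj_on f (verts S) \<and>
        f ` verts S \<subseteq> {0 .. m + nat \<lceil>(real n + 1) / 2\<rceil>} \<and>
        {f x + f y | x y. {x, y} \<in> neg_edges S} = {1..n} \<and>
        {nat \<bar>int (f x) - int (f y)\<bar> | x y. {x, y} \<in> pos_edges S} = {1..m})"

definition additively_graceful :: "'a sgraph \<Rightarrow> bool" where
  "additively_graceful S \<longleftrightarrow>
     signed_graph S \<and> (\<exists>f. additively_graceful_labeling S f)"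

text \<open>The positive edge \<open>z1 z2\<close> with positive pendant edges \<open>z1 v\<^sub>i\<close>
  (\<open>1 \<le> i \<le> l\<close>), negative pendant edges \<open>z1 u\<^sub>1\<close>, \<open>z1 u\<^sub>2\<close> and positive pendant
  edges \<open>z2 w\<^sub>1\<close>, \<open>z2 w\<^sub>2\<close>. This is the intended graph only if the listed vertices
  are pairwise distinct, which is the hypothesis of the lemma below.\<close>

definition pendant_sgraph ::
    "nat \<Rightarrow> 'a \<Rightarrow> 'a \<Rightarrow> (nat \<Rightarrow> 'a) \<Rightarrow> (nat \<Rightarrow> 'a) \<Rightarrow> (nat \<Rightarrow> 'a) \<Rightarrow> 'a sgraph" where
  "pendant_sgraph l z1 z2 u v w =
     \<lparr> verts = {z1, z2} \<union> u ` {1, 2} \<union> v ` {1..l} \<union> w ` {1, 2},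
       pos_edges = {{z1, z2}} \<union> (\<lambda>i. {z1, v i}) ` {1..l} \<union> (\<lambda>i. {z2, w i}) ` {1, 2},
       neg_edges = (\<lambda>i. {z1, u i}) ` {1, 2} \<rparr>"

lemma pmn_signed_graph_pendant_sgraph:
  assumes d: "distinct ([z1, z2] @ map u [1, 2] @ map v [1..<Suc l] @ map w [1, 2])"
  shows "pmn_signed_graph (l + 6) (l + 3) 2 (pendant_sgraph l z1 z2 u v w)"
proof -
  let ?S = "pendant_sgraph l z1 z2 u v w"
  let ?xs = "[z1, z2] @ map u [1, 2] @ map v [1..<Suc l] @ map w [1, 2]"
  have iv: "set [1..<Suc l] = {1..l}" by auto
  have injv: "inj_on v {1..l}"
    using d unfolding distinct_append distinct_map iv by blast
  have vs: "verts ?S = set ?xs"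
    unfolding pendant_sgraph_def by (auto simp del: upt_Suc)
  have cv: "card (verts ?S) = l + 6"
    unfolding vs distinct_card[OF d] by simp
  have z: "z1 \<noteq> z2" "z1 \<noteq> u 1" "z1 \<noteq> u 2" "z1 \<noteq> w 1" "z1 \<noteq> w 2"
      "z2 \<noteq> u 1" "z2 \<noteq> u 2" "z2 \<noteq> w 1" "z2 \<noteq> w 2"
      "u 1 \<noteq> u 2" "u 1 \<noteq> w 1" "u 1 \<noteq> w 2" "u 2 \<noteq> w 1" "u 2 \<noteq> w 2" "w 1 \<noteq> w 2"
    using d by simp_all
  have zv: "z1 \<notin> v ` {1..l}" "z2 \<notin> v ` {1..l}" "u 1 \<notin> v ` {1..l}" "u 2 \<notin> v ` {1..l}"
      "w 1 \<notin> v ` {1..l}" "w 2 \<notin> v ` {1..l}"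
    using d unfolding distinct_append set_append set_map iv
    by (simp_all del: upt_Suc)
  have cl: "card ((\<lambda>i. {z1, v i}) ` {1..l}) = l"
  proof (subst card_image)
    show "inj_on (\<lambda>i. {z1, v i}) {1..l}"
      by (rule inj_onI) (metis doubleton_eq_iff injv inj_onD)
  qed simp
  have pe: "pos_edges ?S =
      insert {z1, z2} (insert {z2, w 1} (insert {z2, w 2} ((\<lambda>i. {z1, v i}) ` {1..l})))"
    unfolding pendant_sgraph_def by auto
  have a1: "{z1, z2} \<notin> (\<lambda>i. {z1, v i}) ` {1..l}"
    using z(1) zv(2) by (fastforce simp: doubleton_eq_iff)
  have a2: "{z2, w i} \<notin> (\<lambda>i. {z1, v i}) ` {1..l}" if "i = 1 \<or> i = 2" for i
  proof -
    have "z1 \<notin> {z2, w i}" using z that by auto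
    then show ?thesis by blast
  qed
  have a3: "{z1, u i} \<notin> (\<lambda>i. {z1, v i}) ` {1..l}" if "i = 1 \<or> i = 2" for i
  proof
    assume "{z1, u i} \<in> (\<lambda>i. {z1, v i}) ` {1..l}"
    then obtain j where "j \<in> {1..l}" "{z1, u i} = {z1, v j}" by blast
    then have "u i \<in> v ` {1..l}" by (metis doubleton_eq_iff imageI)
    then show False using zv that by blast
  qed
  have cp: "card (pos_edges ?S) = l + 3"
    unfolding pe using cl a1 a2[of 1] a2[of 2] z by (simp add: doubleton_eq_iff)
  have ne: "neg_edges ?S = {{z1, u 1}, {z1, u 2}}"
    unfolding pendant_sgraph_def by simp
  have cn: "card (neg_edges ?S) = 2"
    unfolding ne using z by (simp add: doubleton_eq_iff)
  have "{z1, u i} \<notin> pos_edges ?S" if "i = 1 \<or> i = 2" for i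
    unfolding pe using a3[OF that] z that by (auto simp: doubleton_eq_iff)
  then have "pos_edges ?S \<inter> neg_edges ?S = {}"
    unfolding ne by blast
  moreover have "e \<subseteq> verts ?S \<and> card e = 2" if e: "e \<in> pos_edges ?S \<union> neg_edges ?S" for e
  proof -
    consider "e = {z1, z2}" | i where "i \<in> {1, 2}" "e = {z2, w i}"
      | i where "i \<in> {1..l}" "e = {z1, v i}" | i where "i \<in> {1, 2}" "e = {z1, u i}"
      using e unfolding pe ne by blast
    then show ?thesis
    proof cases
      case 1 then show ?thesis using z by (simp add: pendant_sgraph_def)
    next
      case 2
      then have "z2 \<noteq> w i" using z by blast
      then show ?thesis using 2 by (auto simp: pendant_sgraph_def)
    next
      case 3
      then have "z1 \<noteq> v i" using zv by blast
      then show ?thesis using 3 by (simp add: pendant_sgraph_def)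
    next
      case 4
      then have "z1 \<noteq> u i" using z by blast
      then show ?thesis using 4 by (auto simp: pendant_sgraph_def)
    qed
  qed
  moreover have "finite (verts ?S)" unfolding vs by simp
  ultimately show ?thesis
    using cv cp cn unfolding pmn_signed_graph_def signed_graph_def by blast
qed

end

theory Submission
  imports Defs
begin

text \<open>A labeling takes values in \<open>{0..l + 5}\<close>, because there are \<open>l + 3\<close> positive and two
  negative edges, and the graph has \<open>l + 6\<close> vertices. So every label is used exactly once, and
  this rigidity forces everything.

  \<^item> The negative edges have sums 1 and 2 and share the end \<open>z1\<close>. As labels are distinct, only
    \<open>z1 = 0\<close> with \<open>u\<close>-labels \<open>1, 2\<close> is possible.
  \<^item> Since \<open>z1\<close> is 0, the labels of \<open>z2\<close> and of the \<open>v i\<close> are themselves labels of positive edges,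
    so they are at most \<open>l + 3\<close>; and 0, 1, 2 are taken. These \<open>l + 1\<close> distinct labels therefore
    fill \<open>{3..l + 3}\<close>, which leaves exactly \<open>l + 4, l + 5\<close> for the \<open>w i\<close>.
  \<^item> The edge label 1 must still occur, and only an edge \<open>z2 w i\<close> can carry it. As the label of
    \<open>z2\<close> is at most \<open>l + 3\<close> and that of \<open>w i\<close> at least \<open>l + 4\<close>, the label of \<open>z2\<close> is \<open>l + 3\<close>.

  Conversely every map with these values is a labeling. The lemma
  \<open>additively_graceful_labeling_pendant_iff\<close> records this equivalence; existence
  follows by writing down one such map, and uniqueness because two injective enumerations of the
  same set of labels differ by a permutation of the indices.\<close>

lemma same_image_imp_permutation:
  assumes "inj_on p I" "inj_on q I" "p ` I = q ` I"
  shows "\<exists>\<pi>. \<pi> permutes I \<and> (\<forall>i\<in>I. q i = p (\<pi> i))"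
proof -
  define \<pi> where "\<pi> = (\<lambda>i. if i \<in> I then inv_into I p (q i) else i)"
  have "bij_betw (inv_into I p \<circ> q) I I"
    using assms by (intro bij_betw_trans[OF _ bij_betw_inv_into]) (auto simp: bij_betw_def)
  then have "bij_betw \<pi> I I"
    by (rule bij_betw_cong[THEN iffD1, rotated]) (simp add: \<pi>_def)
  then have "\<pi> permutes I"
    by (rule bij_imp_permutes) (simp add: \<pi>_def)
  moreover have "q i = p (\<pi> i)" if "i \<in> I" for i
    using that assms(3) by (simp add: \<pi>_def f_inv_into_f)
  ultimately show ?thesis by blast
qed

lemma negative_labels_pendant:
  "{f x + f y | x y. {x, y} \<in> neg_edges (pendant_sgraph l z1 z2 u v w)} =
   {f z1 + f (u 1), f z1 + f (u 2) :: nat}"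
  by (auto simp: pendant_sgraph_def doubleton_eq_iff)

lemma positive_labels_pendant:
  fixes f :: "'a \<Rightarrow> nat"
  defines "d \<equiv> \<lambda>x y. nat \<bar>int (f x) - int (f y)\<bar>"
  shows "{nat \<bar>int (f x) - int (f y)\<bar> | x y. {x, y} \<in> pos_edges (pendant_sgraph l z1 z2 u v w)} =
    {d z1 z2} \<union> (\<lambda>i. d z1 (v i)) ` {1..l} \<union> {d z2 (w 1), d z2 (w 2)}" (is "?L = ?R")
proof
  have sym: "d x y = d y x" for x y by (simp add: d_def abs_minus_commute)
  show "?L \<subseteq> ?R"
  proof
    fix k assume "k \<in> ?L"
    then obtain x y where k: "k = d x y"
      and e: "{x, y} \<in> pos_edges (pendant_sgraph l z1 z2 u v w)"
      unfolding d_def by blast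
    from e consider "{x, y} = {z1, z2}" | i where "i \<in> {1..l}" "{x, y} = {z1, v i}"
      | "{x, y} = {z2, w 1}" | "{x, y} = {z2, w 2}"
      by (auto simp: pendant_sgraph_def)
    then show "k \<in> ?R"
      by cases (auto simp: k doubleton_eq_iff sym)
  qed
  have "d x y \<in> ?L" if "{x, y} \<in> pos_edges (pendant_sgraph l z1 z2 u v w)" for x y
    using that unfolding d_def by blast
  then show "?R \<subseteq> ?L" by (auto simp: pendant_sgraph_def)
qed

lemma distinct_pendant_verticesD:
  assumes "distinct ([z1, z2] @ map u [1, 2] @ map v [1..<Suc l] @ map w [1, 2])"
  shows "inj_on v {1..l}" "v ` {1..l} \<inter> {z1, z2, u 1, u 2, w 1, w 2} = {}"
proof -
  have iv: "set [1..<Suc l] = {1..l}" by auto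
  show "inj_on v {1..l}"
    using assms unfolding distinct_append distinct_map iv by blast
  show "v ` {1..l} \<inter> {z1, z2, u 1, u 2, w 1, w 2} = {}"
    using assms unfolding distinct_append set_append set_map iv
    by (simp del: upt_Suc)
qed

text \<open>Left to right this is the rigidity argument above. Right to left the listed values already
  cover \<open>{0..l + 5}\<close>, so injectivity comes for free by counting the \<open>l + 6\<close> vertices; and the
  edge labels 1 and 2, which the positive edges at \<open>z1\<close> miss, are the differences of \<open>l + 4\<close> and \<open>l + 5\<close>
  to \<open>l + 3\<close>.\<close>

lemma additively_graceful_labeling_pendant_iff:
  assumes d: "distinct ([z1, z2] @ map u [1, 2] @ map v [1..<Suc l] @ map w [1, 2])"
  shows "additively_graceful_labeling (pendant_sgraph l z1 z2 u v w) f \<longleftrightarrow>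
    f z1 = 0 \<and> f z2 = l + 3 \<and> f ` u ` {1, 2} = {1, 2} \<and>
    f ` v ` {1..l} = {3..l + 2} \<and> f ` w ` {1, 2} = {l + 4, l + 5}"
    (is "additively_graceful_labeling ?S f \<longleftrightarrow> ?R")
proof -
  note injv = distinct_pendant_verticesD(1)[OF d]
  have z: "z1 \<noteq> z2" "z1 \<noteq> u 1" "z1 \<noteq> u 2" "z1 \<noteq> w 1" "z1 \<noteq> w 2"
      "z2 \<noteq> u 1" "z2 \<noteq> u 2" "z2 \<noteq> w 1" "z2 \<noteq> w 2"
      "u 1 \<noteq> u 2" "u 1 \<noteq> w 1" "u 1 \<noteq> w 2" "u 2 \<noteq> w 1" "u 2 \<noteq> w 2" "w 1 \<noteq> w 2"
    using d by simp_all
  have zv: "z1 \<notin> v ` {1..l}" "z2 \<notin> v ` {1..l}" "u 1 \<notin> v ` {1..l}" "u 2 \<notin> v ` {1..l}"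
      "w 1 \<notin> v ` {1..l}" "w 2 \<notin> v ` {1..l}"
    using distinct_pendant_verticesD(2)[OF d] by blast+
  let ?V = "verts ?S"
  have V: "?V = {z1, u 1, u 2} \<union> insert z2 (v ` {1..l}) \<union> {w 1, w 2}"
    by (auto simp: pendant_sgraph_def)
  have finV: "finite ?V" by (simp add: V)
  have card: "card ?V = l + 6" "card (pos_edges ?S) = l + 3" "card (neg_edges ?S) = 2"
    using pmn_signed_graph_pendant_sgraph[OF d] by (auto simp: pmn_signed_graph_def)
  have "nat \<lceil>(real 2 + 1) / 2\<rceil> = 2" by (simp add: ceiling_divide_eq_div)
  then have unfold: "additively_graceful_labeling ?S f \<longleftrightarrow>
      inj_on f ?V \<and> f ` ?V \<subseteq> {0..l + 5} \<and>
      {f z1 + f (u 1), f z1 + f (u 2)} = {1..2} \<and>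
      {nat \<bar>int (f z1) - int (f z2)\<bar>} \<union>
        (\<lambda>i. nat \<bar>int (f z1) - int (f (v i))\<bar>) ` {1..l} \<union>
        {nat \<bar>int (f z2) - int (f (w 1))\<bar>, nat \<bar>int (f z2) - int (f (w 2))\<bar>} = {1..l + 3}"
    (is "_ \<longleftrightarrow> _ \<and> _ \<and> _ \<and> ?P = _")
    unfolding additively_graceful_labeling_def Let_def card
      negative_labels_pendant positive_labels_pendant
    by (simp add: add.commute)
  have two: "{1..2} = {1, 2 :: nat}" by auto
  show ?thesis
  proof
    assume "additively_graceful_labeling ?S f"
    then have inj: "inj_on f ?V" and ran: "f ` ?V \<subseteq> {0..l + 5}"
      and neg: "{f z1 + f (u 1), f z1 + f (u 2)} = {1, 2}" and pos: "?P = {1..l + 3}"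
      unfolding unfold two by blast+
    have onto: "f ` ?V = {0..l + 5}"
      using ran by (intro card_subset_eq) (simp_all add: card_image[OF inj] card)
    \<comment> \<open>These inequalities exclude the only other solution, \<open>f z1 = 1\<close> with 0 and 1 on the
      \<open>u i\<close>.\<close>
    have "f z1 \<noteq> f (u 1)" "f z1 \<noteq> f (u 2)"
      using inj z unfolding inj_on_def V by blast+
    with neg have z1: "f z1 = 0" and u: "f ` {u 1, u 2} = {1, 2}"
      by (auto simp: doubleton_eq_iff)
    let ?B = "insert z2 (v ` {1..l})"
    \<comment> \<open>As \<open>f z1 = 0\<close>, the label of a positive neighbour of \<open>z1\<close> is that of the edge joining
      them.\<close>
    have "f ` ?B \<subseteq> ?P" by (auto simp: z1)
    moreover have "f ` ?B \<inter> f ` {z1, u 1, u 2} = f ` (?B \<inter> {z1, u 1, u 2})"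
      by (rule inj_on_image_Int[OF inj, symmetric]) (auto simp: V)
    then have "f ` ?B \<inter> {0, 1, 2} = {}"
      using z zv z1 u by auto
    moreover have "k \<in> {3..l + 3}" if "k \<in> {1..l + 3}" "k \<notin> {0, 1, 2}" for k :: nat
      using that by auto
    ultimately have sub: "f ` ?B \<subseteq> {3..l + 3}" unfolding pos by blast
    have "inj_on f ?B" using inj by (rule inj_on_subset) (auto simp: V)
    then have "card (f ` ?B) = l + 1"
      using zv injv by (simp add: card_image del: image_insert)
    then have B: "f ` ?B = {3..l + 3}"
      using sub by (intro card_subset_eq) simp_all
    \<comment> \<open>Every label is used, so the \<open>w i\<close> take those that the other vertices leave over.\<close>
    have "{w 1, w 2} = ?V - ({z1, u 1, u 2} \<union> ?B)"
      using z zv by (auto simp: V)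
    also have "f ` \<dots> = f ` ?V - f ` ({z1, u 1, u 2} \<union> ?B)"
      using inj by (rule inj_on_image_set_diff) (auto simp: V)
    also have "f ` ({z1, u 1, u 2} \<union> ?B) = {0, 1, 2} \<union> {3..l + 3}"
      unfolding image_Un B using z1 u by auto
    also have "f ` ?V - \<dots> = {l + 4, l + 5}"
      unfolding onto by auto
    finally have w: "f ` {w 1, w 2} = {l + 4, l + 5}" .
    have v: "f (v i) \<in> {3..l + 3}" if "i \<in> {1..l}" for i
      using B that by blast+
    have z2: "f z2 \<in> {3..l + 3}" using B by blast
    have "1 \<in> ?P" unfolding pos by simp
    \<comment> \<open>The other positive edge labels are vertex labels in \<open>{3..l + 3}\<close>.\<close>
    moreover have "1 \<notin> (\<lambda>i. nat \<bar>int (f z1) - int (f (v i))\<bar>) ` {1..l}"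
      using v by (fastforce simp: z1)
    ultimately have "1 \<in> {nat \<bar>int (f z2) - int (f (w 1))\<bar>, nat \<bar>int (f z2) - int (f (w 2))\<bar>}"
      using z2 by (auto simp: z1)
    moreover have "f (w 1) \<ge> l + 4" "f (w 2) \<ge> l + 4"
      using w unfolding image_insert image_empty doubleton_eq_iff by linarith+
    ultimately have z2': "f z2 = l + 3" using z2 by auto
    have "f z2 \<notin> f ` v ` {1..l}"
      using \<open>inj_on f ?B\<close> zv unfolding inj_on_def by blast
    then have "f ` v ` {1..l} = {3..l + 3} - {l + 3}"
      unfolding z2' B[symmetric] by (auto simp: z2')
    also have "\<dots> = {3..l + 2}" by auto
    finally show ?R using z1 z2' u w by simp
  next
    assume R: ?R
    then have u: "{f (u 1), f (u 2)} = {1, 2}" and w: "{f (w 1), f (w 2)} = {l + 4, l + 5}"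
      by auto
    have "f ` ?V = {0} \<union> {f (u 1), f (u 2)} \<union> {l + 3} \<union> {3..l + 2} \<union> {f (w 1), f (w 2)}"
      using R by (auto simp: V)
    also have "\<dots> = {0..l + 5}" unfolding u w by auto
    finally have onto: "f ` ?V = {0..l + 5}" .
    then have "inj_on f ?V"
      using finV by (intro eq_card_imp_inj_on) (simp_all add: card)
    moreover have "{f z1 + f (u 1), f z1 + f (u 2)} = {1..2}"
      unfolding two using R u by simp
    moreover have "?P = {1..l + 3}"
    proof -
      have "(\<lambda>i. nat \<bar>int (f z1) - int (f (v i))\<bar>) ` {1..l} = f ` v ` {1..l}"
        using R by (simp add: image_image)
      also have "\<dots> = {3..l + 2}" using R by blast
      finally have "(\<lambda>i. nat \<bar>int (f z1) - int (f (v i))\<bar>) ` {1..l} = {3..l + 2}" .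
      moreover have "{nat \<bar>int (f z2) - int (f (w 1))\<bar>, nat \<bar>int (f z2) - int (f (w 2))\<bar>} = {1, 2}"
        using w R by (auto simp: doubleton_eq_iff)
      moreover have "nat \<bar>int (f z1) - int (f z2)\<bar> = l + 3" using R by simp
      ultimately have "?P = {l + 3} \<union> {3..l + 2} \<union> {1, 2}" by simp
      also have "\<dots> = {1..l + 3}" by auto
      finally show ?thesis .
    qed
    ultimately show "additively_graceful_labeling ?S f"
      unfolding unfold using onto by simp
  qed
qed

theorem theorem4p4:
  fixes l :: nat and z1 z2 :: 'a and u v w :: "nat \<Rightarrow> 'a" and S :: "'a sgraph"
  assumes "distinct ([z1, z2] @ map u [1, 2] @ map v [1..<Suc l] @ map w [1, 2])"
    and "S = pendant_sgraph l z1 z2 u v w"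
  shows "additively_graceful S \<and>
    (\<forall>f g. additively_graceful_labeling S f \<and> additively_graceful_labeling S g \<longrightarrow>
      (\<exists>\<alpha> \<beta> \<gamma>. \<alpha> permutes {1, 2} \<and> \<beta> permutes {1..l} \<and> \<gamma> permutes {1, 2} \<and>
        g z1 = f z1 \<and> g z2 = f z2 \<and>
        (\<forall>i \<in> {1, 2}. g (u i) = f (u (\<alpha> i))) \<and>
        (\<forall>i \<in> {1..l}. g (v i) = f (v (\<beta> i))) \<and>
        (\<forall>i \<in> {1, 2}. g (w i) = f (w (\<gamma> i)))))"
proof (intro conjI allI impI)
  note iff = additively_graceful_labeling_pendant_iff[OF assms(1), folded assms(2)]
  show "additively_graceful S"
  proof -
    define f where "f = (\<lambda>x. if x = z1 then 0 else if x = z2 then l + 3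
      else if x = u 1 then 1 else if x = u 2 then 2
      else if x = w 1 then l + 4 else if x = w 2 then l + 5
      else inv_into {1..l} v x + 2)"
    have "f (v i) = i + 2" if "i \<in> {1..l}" for i
    proof -
      have "v i \<notin> {z1, z2, u 1, u 2, w 1, w 2}"
        using distinct_pendant_verticesD(2)[OF assms(1)] that by blast
      then show ?thesis
        using inv_into_f_f[OF distinct_pendant_verticesD(1)[OF assms(1)] that] by (simp add: f_def)
    qed
    then have "f ` v ` {1..l} = (\<lambda>i. i + 2) ` {1..l}"
      unfolding image_image by (rule image_cong[OF refl])
    also have "\<dots> = {3..l + 2}"
      unfolding image_add_atLeastAtMost' by simp
    finally have "f ` v ` {1..l} = {3..l + 2}" .
    moreover have "f z1 = 0" "f z2 = l + 3" "f (u 1) = 1" "f (u 2) = 2"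
      "f (w 1) = l + 4" "f (w 2) = l + 5"
      using assms(1) by (auto simp: f_def)
    ultimately have "additively_graceful_labeling S f"
      unfolding iff by simp
    moreover have "signed_graph S"
      using pmn_signed_graph_pendant_sgraph[OF assms(1)] assms(2)
      by (simp add: pmn_signed_graph_def)
    ultimately show ?thesis unfolding additively_graceful_def by blast
  qed
next
  note iff = additively_graceful_labeling_pendant_iff[OF assms(1), folded assms(2)]
  fix f g assume "additively_graceful_labeling S f \<and> additively_graceful_labeling S g"
  then have f: "f z1 = 0" "f z2 = l + 3" "f ` u ` {1, 2} = {1, 2}"
      "f ` v ` {1..l} = {3..l + 2}" "f ` w ` {1, 2} = {l + 4, l + 5}"
    and g: "g z1 = 0" "g z2 = l + 3" "g ` u ` {1, 2} = {1, 2}"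
      "g ` v ` {1..l} = {3..l + 2}" "g ` w ` {1, 2} = {l + 4, l + 5}"
    unfolding iff by (simp_all only:)
  \<comment> \<open>Each family of pendant vertices has as many labels as indices, so the enumerations
    are injective.\<close>
  have perm: "\<exists>\<pi>. \<pi> permutes I \<and> (\<forall>i\<in>I. g (a i) = f (a (\<pi> i)))"
    if "finite I" "f ` a ` I = L" "g ` a ` I = L" "card L = card I"
    for a :: "nat \<Rightarrow> 'a" and I L
    using that
    by (intro same_image_imp_permutation[where p = "\<lambda>i. f (a i)" and q = "\<lambda>i. g (a i)"]
        eq_card_imp_inj_on) (simp_all add: image_image)
  have "\<exists>\<alpha>. \<alpha> permutes {1, 2} \<and> (\<forall>i\<in>{1, 2}. g (u i) = f (u (\<alpha> i)))"
    by (rule perm[OF _ f(3) g(3)]) simp_all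
  moreover have "\<exists>\<beta>. \<beta> permutes {1..l} \<and> (\<forall>i\<in>{1..l}. g (v i) = f (v (\<beta> i)))"
    by (rule perm[OF _ f(4) g(4)]) simp_all
  moreover have "\<exists>\<gamma>. \<gamma> permutes {1, 2} \<and> (\<forall>i\<in>{1, 2}. g (w i) = f (w (\<gamma> i)))"
    by (rule perm[OF _ f(5) g(5)]) simp_all
  ultimately show "\<exists>\<alpha> \<beta> \<gamma>. \<alpha> permutes {1, 2} \<and> \<beta> permutes {1..l} \<and> \<gamma> permutes {1, 2} \<and>
        g z1 = f z1 \<and> g z2 = f z2 \<and>
        (\<forall>i \<in> {1, 2}. g (u i) = f (u (\<alpha> i))) \<and>
        (\<forall>i \<in> {1..l}. g (v i) = f (v (\<beta> i))) \<and>
        (\<forall>i \<in> {1, 2}. g (w i) = f (w (\<gamma> i)))"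
    unfolding f(1,2) g(1,2) by blast
qed

end
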